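(* Let $f$ satisfy assumptions (A1)–(A4) of the context, let $\varepsilon>0$ and $M=4\sqrt2\,\kappa^3\rho$. Run the algorithm MCN (see context) with tolerance $\varepsilon$ and $T=\big\lceil 192\,(P(\mathbf x_0)-P^* )\sqrt M\,\varepsilon^{-1.5}\big\rceil+1$, and suppose the numbers $K_t$ are sufficiently large that at every iteration the produced $\mathbf g_t$ and $\mathbf H_t$ satisfy $$\|\nabla P(\mathbf x_t)-\mathbf g_t\|_2\le C_g\varepsilon,\qquad \|\nabla^2P(\mathbf x_t)-\mathbf H_t\|_2\le C_H\sqrt{M\varepsilon}$$ with $C_g=1/192$ and $C_H=1/48$. Then the output $\hat{\mathbf x}$ is an $\big(\varepsilon,\sqrt{M\varepsilon}\,\big)$-second-order stationary point of $P$.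
   Context: Notation: $\|\cdot\|_2$ is the Euclidean norm of vectors and the spectral norm of matrices. $f:\mathbb R^{d_x}\times\mathbb R^{d_y}\to\mathbb R$ is twice differentiable. Assumptions, with constants $\ell,\rho,\mu>0$: (A1) $\|\nabla f(\mathbf x,\mathbf y)-\nabla f(\mathbf x',\mathbf y')\|_2^2\le \ell^2(\|\mathbf x-\mathbf x'\|_2^2+\|\mathbf y-\mathbf y'\|_2^2)$ for all $\mathbf x,\mathbf x',\mathbf y,\mathbf y'$; (A2) $\|\nabla^2 f(\mathbf x,\mathbf y)-\nabla^2 f(\mathbf x',\mathbf y')\|_2^2\le \rho^2(\|\mathbf x-\mathbf x'\|_2^2+\|\mathbf y-\mathbf y'\|_2^2)$ for all $\mathbf x,\mathbf x',\mathbf y,\mathbf y'$; (A3) $f$ is $\mu$-strongly concave in $\mathbf y$: $f(\mathbf x,\mathbf y)\le f(\mathbf x,\mathbf y')+\nabla_y f(\mathbf x,\mathbf y')^\top(\mathbf y-\mathbf y')-\frac{\mu}{2}\|\mathbf y-\mathbf y'\|_2^2$ for all $\mathbf x,\mathbf y,\mathbf y'$; (A4) $P(\mathbf x)=\max_{\mathbf y\in\mathbb R^{d_y}}f(\mathbf x,\mathbf y)$ satisfies $P^*=\inf_{\mathbf x}P(\mathbf x)>-\infty$. Put $\kappa=\ell/\mu$ and $\mathbf H(\mathbf x,\mathbf y)=\nabla_{xx}^2f(\mathbf x,\mathbf y)-\nabla_{xy}^2f(\mathbf x,\mathbf y)\big(\nabla_{yy}^2f(\mathbf x,\mathbf y)\big)^{-1}\nabla_{yx}^2f(\mathbf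 x,\mathbf y)$. A point $\mathbf x$ is an $(\varepsilon,\delta)$-second-order stationary point of $P$ if $\|\nabla P(\mathbf x)\|_2\le\varepsilon$ and $\nabla^2P(\mathbf x)\succeq-\delta\mathbf I$. AGD$(h,\mathbf y_0,K,\eta,\theta)$: set $\tilde{\mathbf y}_0=\mathbf y_0$; for $k=0,\dots,K-1$ set $\mathbf y_{k+1}=\tilde{\mathbf y}_k-\eta\nabla h(\tilde{\mathbf y}_k)$, $\tilde{\mathbf y}_{k+1}=\mathbf y_{k+1}+\theta(\mathbf y_{k+1}-\mathbf y_k)$; return $\mathbf y_K$. MCN (Minimax Cubic Newton), with inputs $\mathbf x_0\in\mathbb R^{d_x}$, $\mathbf y_{-1}=\mathbf 0$, $T$, $\{K_t\}$ and tolerance $\varepsilon$: for $t=0,\dots,T-1$: $\mathbf y_t=\mathrm{AGD}\big(-f(\mathbf x_t,\cdot),\mathbf y_{t-1},K_t,\frac1\ell,\frac{\sqrt\kappa-1}{\sqrt\kappa+1}\big)$; $\mathbf g_t=\nabla_xf(\mathbf x_t,\mathbf y_t)$, $\mathbf H_t=\mathbf H(\mathbf x_t,\mathbf y_t)$; $\mathbf s_t^*\in\arg\min_{\mathbf s\in\mathbb R^{d_x}}\big(\mathbf g_t^\top\mathbf s+\frac12\mathbf s^\top\mathbf H_t\mathbf s+\frac M6\|\mathbf s\|_2^3\big)$; if $\|\mathbf s_t^*\|_2\le\frac12\sqrt{\varepsilon/M}$ then exit the loop; otherwise $\mathbf x_{t+1}=\mathbf x_t+\mathbf s_t^*$. The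 output is $\hat{\mathbf x}=\mathbf x_t+\mathbf s_t^*$ for the last $t$ executed. *)

theory Defs
  imports "HOL-Analysis.Analysis"
begin

definition grad :: "('a::real_inner \<Rightarrow> real) \<Rightarrow> 'a \<Rightarrow> 'a" where
  "grad f x = (THE D. GDERIV f x :> D)"

(* Second differentiability at x: the gradient exists near x and is Frechet differentiable at x.
   The first conjunct is needed because grad is a total function. *)
definition twice_differentiable_at :: "('a::real_inner \<Rightarrow> real) \<Rightarrow> 'a \<Rightarrow> bool" where
  "twice_differentiable_at f x \<longleftrightarrow>
     (\<forall>\<^sub>F z in nhds x. f differentiable (at z)) \<and> grad f differentiable (at x)"

(* The Hessian as a linear operator; this form also covers product spaces, which
   have no matrix type. On a product, norm is the Euclidean norm of the concatenated vector. *)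
definition hess_op :: "('a::real_inner \<Rightarrow> real) \<Rightarrow> 'a \<Rightarrow> 'a \<Rightarrow> 'a" where
  "hess_op f x = frechet_derivative (grad f) (at x)"

definition hess :: "(real^'n \<Rightarrow> real) \<Rightarrow> real^'n \<Rightarrow> real^'n^'n" where
  "hess f x = jacobian (grad f) (at x)"

(* The library's norm on the type of matrices is the Frobenius norm, hence onorm. *)
definition spectral_norm :: "real^'n^'m \<Rightarrow> real" where
  "spectral_norm A = onorm (\<lambda>v. A *v v)"

definition loewner_ge :: "real^'n^'n \<Rightarrow> real^'n^'n \<Rightarrow> bool" where
  "loewner_ge A B \<longleftrightarrow> transpose (A - B) = A - B \<and> (\<forall>v. 0 \<le> v \<bullet> ((A - B) *v v))"

definition grad_x :: "((real^'n) \<times> (real^'m) \<Rightarrow> real) \<Rightarrow> real^'n \<Rightarrow> real^'m \<Rightarrow> real^'n" where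
  "grad_x f x y = grad (\<lambda>u. f (u, y)) x"

definition grad_y :: "((real^'n) \<times> (real^'m) \<Rightarrow> real) \<Rightarrow> real^'n \<Rightarrow> real^'m \<Rightarrow> real^'m" where
  "grad_y f x y = grad (\<lambda>v. f (x, v)) y"

definition hess_xx :: "((real^'n) \<times> (real^'m) \<Rightarrow> real) \<Rightarrow> real^'n \<Rightarrow> real^'m \<Rightarrow> real^'n^'n" where
  "hess_xx f x y = jacobian (\<lambda>u. grad_x f u y) (at x)"

(* Entry (i, j) of hess_xy is the second partial derivative in x_i and y_j. *)
definition hess_xy :: "((real^'n) \<times> (real^'m) \<Rightarrow> real) \<Rightarrow> real^'n \<Rightarrow> real^'m \<Rightarrow> real^'m^'n" where
  "hess_xy f x y = jacobian (\<lambda>v. grad_x f x v) (at y)"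

definition hess_yx :: "((real^'n) \<times> (real^'m) \<Rightarrow> real) \<Rightarrow> real^'n \<Rightarrow> real^'m \<Rightarrow> real^'n^'m" where
  "hess_yx f x y = jacobian (\<lambda>u. grad_y f u y) (at x)"

definition hess_yy :: "((real^'n) \<times> (real^'m) \<Rightarrow> real) \<Rightarrow> real^'n \<Rightarrow> real^'m \<Rightarrow> real^'m^'m" where
  "hess_yy f x y = jacobian (\<lambda>v. grad_y f x v) (at y)"

definition schur_hess :: "((real^'n) \<times> (real^'m) \<Rightarrow> real) \<Rightarrow> real^'n \<Rightarrow> real^'m \<Rightarrow> real^'n^'n" where
  "schur_hess f x y =
     hess_xx f x y - hess_xy f x y ** matrix_inv (hess_yy f x y) ** hess_yx f x y"

(* An attained maximum, not merely a supremum. *)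
definition primal :: "('a \<times> 'b \<Rightarrow> real) \<Rightarrow> 'a \<Rightarrow> real" where
  "primal f x = (GREATEST v. v \<in> range (\<lambda>y. f (x, y)))"

definition second_order_stationary ::
    "(real^'n \<Rightarrow> real) \<Rightarrow> real \<Rightarrow> real \<Rightarrow> real^'n \<Rightarrow> bool" where
  "second_order_stationary F \<epsilon> \<delta> x \<longleftrightarrow>
     twice_differentiable_at F x \<and>
     norm (grad F x) \<le> \<epsilon> \<and>
     loewner_ge (hess F x) (- (\<delta> *\<^sub>R mat 1))"

(* The state is the pair of y_k and its extrapolation. *)
primrec agd_iter ::
    "('a::real_inner \<Rightarrow> real) \<Rightarrow> 'a \<Rightarrow> real \<Rightarrow> real \<Rightarrow> nat \<Rightarrow> 'a \<times> 'a" where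
  "agd_iter h y0 \<eta> \<theta> 0 = (y0, y0)"
| "agd_iter h y0 \<eta> \<theta> (Suc k) =
     (let (y, z) = agd_iter h y0 \<eta> \<theta> k;
          y' = z - \<eta> *\<^sub>R grad h z
      in (y', y' + \<theta> *\<^sub>R (y' - y)))"

definition agd :: "('a::real_inner \<Rightarrow> real) \<Rightarrow> 'a \<Rightarrow> nat \<Rightarrow> real \<Rightarrow> real \<Rightarrow> 'a" where
  "agd h y0 K \<eta> \<theta> = fst (agd_iter h y0 \<eta> \<theta> K)"

definition cubic_model :: "real^'n \<Rightarrow> real^'n^'n \<Rightarrow> real \<Rightarrow> real^'n \<Rightarrow> real" where
  "cubic_model g H M s = g \<bullet> s + (1/2) * (s \<bullet> (H *v s)) + (M/6) * norm s ^ 3"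

(* The sequences x, y, s, up to index N, form an execution of Minimax Cubic Newton whose last
   executed iteration is N. A relation, since the cubic subproblem may have several minimizers.
   The output of the execution is x N + s N, whether the loop exits early or runs out. *)
definition mcn_run ::
    "((real^'n) \<times> (real^'m) \<Rightarrow> real) \<Rightarrow> real \<Rightarrow> real \<Rightarrow> real \<Rightarrow> real \<Rightarrow> nat \<Rightarrow> (nat \<Rightarrow> nat) \<Rightarrow> real^'n \<Rightarrow>
     nat \<Rightarrow> (nat \<Rightarrow> real^'n) \<Rightarrow> (nat \<Rightarrow> real^'m) \<Rightarrow> (nat \<Rightarrow> real^'n) \<Rightarrow> bool" where
  "mcn_run f L \<kappa> M \<epsilon> T K x0 N x y s \<longleftrightarrow>
     N < T \<and>
     x 0 = x0 \<and>
     (\<forall>t\<le>N. y t = agd (\<lambda>v. - f (x t, v)) (if t = 0 then 0 else y (t - 1)) (K t)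
                    (1 / L) ((sqrt \<kappa> - 1) / (sqrt \<kappa> + 1))) \<and>
     (\<forall>t\<le>N. is_arg_min (cubic_model (grad_x f (x t) (y t)) (schur_hess f (x t) (y t)) M)
                    (\<lambda>_. True) (s t)) \<and>
     (\<forall>t<N. \<not> norm (s t) \<le> (1/2) * sqrt (\<epsilon> / M) \<and> x (Suc t) = x t + s t) \<and>
     (norm (s N) \<le> (1/2) * sqrt (\<epsilon> / M) \<or> Suc N = T)"

end

theory Submission
  imports Defs
begin

text \<open>
The primal function \<open>P\<close> is twice differentiable with Hessian \<open>schur_hess f u (maximizer u)\<close>, this Hessian is
Lipschitz with constant \<open>M\<close>, and under that condition an inexact cubic Newton method finds a second-order
stationary point after boundedly many steps.

For the regularity of \<open>P\<close>: strong concavity makes the maximizer \<open>y*(u)\<close> Lipschitz with constant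
\<open>\<kappa> = L / \<mu>\<close>, and linearizing \<open>grad_y f u (y*(u)) = 0\<close> shows that it is differentiable
(\<open>maximizer_derivative\<close>). The chain rule then gives gradient and Hessian of \<open>P\<close>. The Lipschitz bound
(\<open>schur_hess_lipschitz\<close>) exploits that \<open>k \<bullet> (schur_hess f u v *v h)\<close> equals the full Hessian form of \<open>f\<close> on
\<open>(h, response h)\<close> and \<open>(k, w)\<close> for every \<open>w\<close>. The freedom in \<open>w\<close>, together with the symmetry of the Hessian,
makes it possible to evaluate the forms at two points on the same pair of vectors; so the difference of the Schur
complements is bounded by that of the Hessians of \<open>f\<close>.

For the algorithm: a global minimizer \<open>s\<close> of the cubic model satisfies \<open>g + H s + M/2 \<parallel>s\<parallel> s = 0\<close> and
\<open>H + M/2 \<parallel>s\<parallel> I \<succeq> 0\<close> (\<open>cubic_model_minimizer\<close>). Put \<open>e = sqrt (\<epsilon> / M)\<close>, so that the tolerances are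
\<open>\<epsilon> = M e\<^sup>2\<close> and \<open>sqrt (M \<epsilon>) = M e\<close>. A step longer than \<open>e/2\<close> decreases \<open>P\<close> by more than \<open>M e\<^sup>3 / 192\<close>
(\<open>long_step_decreases\<close>); this cannot happen in all \<open>T\<close> iterations, because the total would exceed
\<open>P x0 - inf P\<close>. So the last step is at most \<open>e/2\<close> long, and then the optimality conditions carry over to
\<open>x + s\<close> as bounds on the gradient and the Hessian of \<open>P\<close> (\<open>short_step_gradient\<close>,
\<open>short_step_curvature\<close>).
\<close>

section \<open>Gradients, Hessians and Jacobians\<close>

lemma grad_eqI:
  assumes "(f has_derivative (\<lambda>h. g \<bullet> h)) (at x)"
  shows "grad f x = g"
proof -
  have "GDERIV f x :> D \<longleftrightarrow> D = g" for D
  proof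
    assume "GDERIV f x :> D"
    then have "(\<lambda>h. h \<bullet> D) = (\<lambda>h. g \<bullet> h)"
      using has_derivative_unique assms unfolding gderiv_def by blast
    then show "D = g"
      by (metis inner_commute vector_eq_ldot)
  qed (use assms in \<open>simp add: gderiv_def inner_commute\<close>)
  then show ?thesis
    unfolding grad_def by (auto intro: the_equality)
qed

text \<open>In finite dimension every linear functional is an inner product, so the gradient exists as soon as
the derivative does.\<close>

lemma has_derivative_grad:
  fixes f :: "'a::euclidean_space \<Rightarrow> real"
  assumes "f differentiable (at x)"
  shows "(f has_derivative (\<lambda>h. grad f x \<bullet> h)) (at x)"
proof -
  obtain f' where f': "(f has_derivative f') (at x)"
    using assms unfolding differentiable_def by blast
  define g where "g = (\<Sum>b\<in>Basis. f' b *\<^sub>R b)"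
  have "f' h = g \<bullet> h" for h
  proof -
    have "f' h = f' (\<Sum>b\<in>Basis. (h \<bullet> b) *\<^sub>R b)"
      by (simp add: euclidean_representation)
    also have "\<dots> = (\<Sum>b\<in>Basis. (h \<bullet> b) * f' b)"
      using has_derivative_linear[OF f'] by (simp add: linear_sum linear_cmul)
    finally show ?thesis
      by (simp add: g_def inner_sum_right inner_commute[of _ h] mult.commute)
  qed
  then have "(f has_derivative (\<lambda>h. g \<bullet> h)) (at x)"
    using f' by (metis (no_types, lifting) ext)
  then show ?thesis
    using grad_eqI by metis
qed

text \<open>Symmetry of the second derivative: the second difference
\<open>f (x + t u + t v) - f (x + t u) - f (x + t v) + f x\<close> is symmetric in \<open>u\<close> and \<open>v\<close>, and up to \<open>o(t\<^sup>2)\<close> it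
equals \<open>t\<^sup>2 (D v \<bullet> u)\<close> by the mean value theorem along \<open>u\<close>, and \<open>t\<^sup>2 (D u \<bullet> v)\<close> by that along \<open>v\<close>.\<close>

lemma derivative_of_gradient_symmetric:
  fixes f :: "'a::real_inner \<Rightarrow> real"
  assumes G: "\<And>z. (f has_derivative (\<lambda>h. G z \<bullet> h)) (at z)"
    and D: "(G has_derivative D) (at x)"
  shows "D u \<bullet> v = u \<bullet> D v"
proof -
  note lin = has_derivative_linear[OF D]
  have bound: "\<bar>D v \<bullet> u - D u \<bullet> v\<bar> \<le> e * (2 * (norm u + norm v)\<^sup>2)" if e: "e > 0" for e
  proof -
    obtain d where d: "d > 0"
      "\<And>y. norm (y - x) < d \<Longrightarrow> norm (G y - G x - D (y - x)) \<le> e * norm (y - x)"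
      using D e unfolding has_derivative_at_alt by blast
    define N where "N = norm u + norm v"
    \<comment> \<open>All points at which \<open>G\<close> is evaluated lie within distance \<open>t * N < d\<close> of \<open>x\<close>.\<close>
    define t where "t = d / (N + 1)"
    have N: "N \<ge> 0" unfolding N_def by simp
    have t: "t > 0" unfolding t_def using d N by simp
    have tN: "t * N < d"
    proof -
      have "t * N < t * (N + 1)" using t by simp
      then show ?thesis unfolding t_def using N by simp
    qed
    define \<Delta> where "\<Delta> = f (x + t *\<^sub>R u + t *\<^sub>R v) - f (x + t *\<^sub>R u) - f (x + t *\<^sub>R v) + f x"
    have side: "\<bar>\<Delta> - t\<^sup>2 * (D b \<bullet> a)\<bar> \<le> 2 * e * t\<^sup>2 * N * norm a"
      if ab: "a = u \<and> b = v \<or> a = v \<and> b = u" for a b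
    proof -
      have Nab: "norm a + norm b = N" using ab unfolding N_def by auto
      have Del: "\<Delta> = f (x + t *\<^sub>R a + t *\<^sub>R b) - f (x + t *\<^sub>R b) - (f (x + t *\<^sub>R a) - f x)"
        using ab unfolding \<Delta>_def by (auto simp: algebra_simps)
      define \<phi> where "\<phi> \<sigma> = f (x + \<sigma> *\<^sub>R a + t *\<^sub>R b) - f (x + \<sigma> *\<^sub>R a)" for \<sigma>
      have der: "(\<phi> has_real_derivative
          G (x + \<sigma> *\<^sub>R a + t *\<^sub>R b) \<bullet> a - G (x + \<sigma> *\<^sub>R a) \<bullet> a) (at \<sigma>)" for \<sigma>
        unfolding \<phi>_def has_field_derivative_def
        by (rule derivative_eq_intros has_derivative_compose[OF _ G] refl | simp add: algebra_simps fun_eq_iff)+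
      obtain \<xi> where \<xi>: "0 < \<xi>" "\<xi> < t"
        and mvt: "\<phi> t - \<phi> 0 = (t - 0) * (G (x + \<xi> *\<^sub>R a + t *\<^sub>R b) \<bullet> a - G (x + \<xi> *\<^sub>R a) \<bullet> a)"
        using MVT2[OF t der] by blast
      \<comment> \<open>The remainders of the linearization at \<open>x\<close>, at the two points where the mean value theorem evaluates \<open>G\<close>.\<close>
      define r where "r y = G y - G x - D (y - x)" for y
      have r: "norm (r (x + w)) \<le> e * (t * N)" if "norm w \<le> t * N" for w
      proof -
        have "norm (r (x + w)) \<le> e * norm w"
          using d(2)[of "x + w"] that tN unfolding r_def by simp
        also have "\<dots> \<le> e * (t * N)" using that e by simp
        finally show ?thesis .
      qed
      have n1: "norm (\<xi> *\<^sub>R a + t *\<^sub>R b) \<le> t * N"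
      proof -
        have "norm (\<xi> *\<^sub>R a + t *\<^sub>R b) \<le> \<xi> * norm a + t * norm b"
          using \<xi> t by (metis abs_of_pos norm_scaleR norm_triangle_ineq)
        also have "\<dots> \<le> t * norm a + t * norm b"
          using \<xi> by (simp add: mult_right_mono)
        finally show ?thesis using Nab by (simp add: distrib_left[symmetric])
      qed
      have n2: "norm (\<xi> *\<^sub>R a) \<le> t * N"
      proof -
        have "norm (\<xi> *\<^sub>R a) \<le> t * norm a" using \<xi> by (simp add: mult_right_mono)
        also have "\<dots> \<le> t * N" using t Nab by (smt (verit) mult_left_mono norm_ge_zero)
        finally show ?thesis .
      qed
      define q where "q = r (x + (\<xi> *\<^sub>R a + t *\<^sub>R b)) - r (x + \<xi> *\<^sub>R a)"
      have q: "norm q \<le> 2 * e * t * N"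
        using r[OF n1] r[OF n2] norm_triangle_ineq4[of "r (x + (\<xi> *\<^sub>R a + t *\<^sub>R b))" "r (x + \<xi> *\<^sub>R a)"]
        unfolding q_def by simp
      have "G (x + \<xi> *\<^sub>R a + t *\<^sub>R b) - G (x + \<xi> *\<^sub>R a) = t *\<^sub>R D b + q"
        unfolding q_def r_def by (simp add: linear_add[OF lin] linear_cmul[OF lin] algebra_simps)
      then have "\<Delta> = t * ((t *\<^sub>R D b + q) \<bullet> a)"
        using mvt unfolding Del \<phi>_def by (simp add: inner_diff_left[symmetric] algebra_simps)
      then have "\<Delta> - t\<^sup>2 * (D b \<bullet> a) = t * (q \<bullet> a)"
        by (simp add: inner_add_left algebra_simps power2_eq_square)
      moreover have "\<bar>q \<bullet> a\<bar> \<le> 2 * e * t * N * norm a"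
        using Cauchy_Schwarz_ineq2[of q a] mult_right_mono[OF q norm_ge_zero[of a]] by linarith
      ultimately show ?thesis
        using t by (simp add: abs_mult power2_eq_square mult_left_mono algebra_simps)
    qed
    have "\<bar>t\<^sup>2 * (D v \<bullet> u) - t\<^sup>2 * (D u \<bullet> v)\<bar> \<le> 2 * e * t\<^sup>2 * N * norm u + 2 * e * t\<^sup>2 * N * norm v"
      using side[OF disjI1, of u v] side[OF disjI2, of v u] by simp
    also have "\<dots> = t\<^sup>2 * (e * (2 * N\<^sup>2))"
      unfolding N_def by (simp add: algebra_simps power2_eq_square)
    finally have "t\<^sup>2 * \<bar>D v \<bullet> u - D u \<bullet> v\<bar> \<le> t\<^sup>2 * (e * (2 * N\<^sup>2))"
      by (simp add: right_diff_distrib[symmetric] abs_mult)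
    then show ?thesis
      using t unfolding N_def by simp
  qed
  have "\<bar>D v \<bullet> u - D u \<bullet> v\<bar> \<le> 0"
  proof (rule field_le_epsilon)
    fix e :: real assume e: "e > 0"
    define C where "C = 2 * (norm u + norm v)\<^sup>2"
    have C: "C \<ge> 0" unfolding C_def by simp
    have "\<bar>D v \<bullet> u - D u \<bullet> v\<bar> \<le> e / (C + 1) * C"
      unfolding C_def using e by (intro bound) (simp add: add_nonneg_pos)
    also have "\<dots> \<le> e"
      using C e by (simp add: field_simps)
    finally show "\<bar>D v \<bullet> u - D u \<bullet> v\<bar> \<le> 0 + e" by simp
  qed
  then show ?thesis by (simp add: inner_commute)
qed

lemma directional_derivative_limit:
  fixes g :: "'a::real_normed_vector \<Rightarrow> 'b::real_inner"
  assumes "(g has_derivative D) (at x)"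
  shows "((\<lambda>t. (g (x + t *\<^sub>R h) - g x) /\<^sub>R t) \<longlongrightarrow> D h) (at_right 0)"
proof -
  have lin: "linear D" using has_derivative_linear[OF assms] .
  have "((\<lambda>t. g (x + t *\<^sub>R h)) has_derivative (\<lambda>t. D (t *\<^sub>R h))) (at 0)"
    by (rule has_derivative_compose[where g = g]) (auto intro!: derivative_eq_intros assms)
  then have "((\<lambda>t. norm (g (x + t *\<^sub>R h) - g x - D (t *\<^sub>R h)) / norm t) \<longlongrightarrow> 0) (at 0)"
    unfolding has_derivative_at by simp
  then have "((\<lambda>t. norm ((g (x + t *\<^sub>R h) - g x) /\<^sub>R t - D h)) \<longlongrightarrow> 0) (at 0)"
  proof (rule Lim_transform_eventually)
    have "norm (g (x + t *\<^sub>R h) - g x - D (t *\<^sub>R h)) / norm t = norm ((g (x + t *\<^sub>R h) - g x) /\<^sub>R t - D h)"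
      if "t \<noteq> 0" for t
    proof -
      have "(g (x + t *\<^sub>R h) - g x) /\<^sub>R t - D h = (g (x + t *\<^sub>R h) - g x - D (t *\<^sub>R h)) /\<^sub>R t"
        using that by (simp add: linear_cmul[OF lin] scaleR_diff_right)
      then show ?thesis by (simp only: norm_scaleR) (simp add: divide_inverse mult.commute)
    qed
    then show "\<forall>\<^sub>F t in at 0. norm (g (x + t *\<^sub>R h) - g x - D (t *\<^sub>R h)) / norm t
        = norm ((g (x + t *\<^sub>R h) - g x) /\<^sub>R t - D h)"
      by (intro eventually_at_filter[THEN iffD2] always_eventually) blast
  qed
  then have "((\<lambda>t. (g (x + t *\<^sub>R h) - g x) /\<^sub>R t) \<longlongrightarrow> D h) (at 0)"
    by (simp only: tendsto_norm_zero_iff LIM_zero_iff)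
  then show ?thesis
    by (rule tendsto_mono[rotated]) (simp add: at_le)
qed

lemma jacobian_mult:
  fixes g :: "real^'a \<Rightarrow> real^'b"
  assumes "(g has_derivative D) (at x)"
  shows "jacobian g (at x) *v h = D h"
proof -
  have "(g has_derivative (\<lambda>h. jacobian g (at x) *v h)) (at x)"
    using assms jacobian_works differentiableI by blast
  from has_derivative_unique[OF this assms] show ?thesis by (rule fun_cong)
qed

lemma norm_snd_le_norm: "norm (snd p) \<le> norm p"
  by (cases p) (simp add: norm_snd_le)

lemma norm_Pair_le_sqrt:
  assumes "norm w \<le> c * norm p"
  shows "norm (p, w) \<le> sqrt (1 + c\<^sup>2) * norm p"
proof -
  have "(norm w)\<^sup>2 \<le> (c * norm p)\<^sup>2" using assms by (intro power_mono) auto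
  then have "(norm p)\<^sup>2 + (norm w)\<^sup>2 \<le> (1 + c\<^sup>2) * (norm p)\<^sup>2"
    by (simp add: power_mult_distrib algebra_simps)
  then have "norm (p, w) \<le> sqrt ((1 + c\<^sup>2) * (norm p)\<^sup>2)"
    unfolding norm_Pair by (rule real_sqrt_le_mono)
  then show ?thesis by (simp add: real_sqrt_mult)
qed

section \<open>Taylor bounds under a Lipschitz Hessian\<close>

text \<open>Integrating \<open>\<parallel>B (x + \<tau> s) s - B x s\<parallel> \<le> M \<tau> \<parallel>s\<parallel>\<^sup>2\<close> over \<open>\<tau>\<close>. Pairing with the remainder \<open>u\<close> itself makes the
integrand scalar, so a monotonicity argument takes the place of a vector-valued integral.\<close>

lemma gradient_taylor_bound:
  fixes G :: "'a::real_inner \<Rightarrow> 'a"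
  assumes G: "\<And>z. (G has_derivative B z) (at z)"
    and lip: "\<And>z h. norm (B z h - B x h) \<le> M * norm (z - x) * norm h"
  shows "norm (G (x + s) - G x - B x s) \<le> M / 2 * (norm s)\<^sup>2"
proof -
  define u where "u = G (x + s) - G x - B x s"
  define \<phi> where "\<phi> \<tau> = (G (x + \<tau> *\<^sub>R s) - G x - \<tau> *\<^sub>R B x s) \<bullet> u - M / 2 * (norm s)\<^sup>2 * norm u * \<tau>\<^sup>2" for \<tau>
  have lin: "linear (B z)" for z using has_derivative_linear[OF G] .
  have der: "(\<phi> has_real_derivative
      (B (x + \<tau> *\<^sub>R s) s - B x s) \<bullet> u - M * (norm s)\<^sup>2 * norm u * \<tau>) (at \<tau>)" for \<tau>
    unfolding \<phi>_def has_field_derivative_def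
    by (rule derivative_eq_intros has_derivative_compose[OF _ G] refl
        | simp add: algebra_simps fun_eq_iff linear_cmul[OF lin])+
  have "\<phi> 1 \<le> \<phi> 0"
  proof (rule DERIV_nonpos_imp_nonincreasing[of 0 1 \<phi>])
    fix \<tau> :: real assume \<tau>: "0 \<le> \<tau>" "\<tau> \<le> 1"
    have "(B (x + \<tau> *\<^sub>R s) s - B x s) \<bullet> u \<le> norm (B (x + \<tau> *\<^sub>R s) s - B x s) * norm u"
      by (rule norm_cauchy_schwarz)
    also have "\<dots> \<le> M * norm ((x + \<tau> *\<^sub>R s) - x) * norm s * norm u"
      by (intro mult_right_mono lip) simp
    also have "\<dots> = M * (norm s)\<^sup>2 * norm u * \<tau>"
      using \<tau> by (simp add: power2_eq_square)
    finally show "\<exists>y. (\<phi> has_real_derivative y) (at \<tau>) \<and> y \<le> 0"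
      using der[of \<tau>] by (intro exI conjI) auto
  qed simp
  then have "norm u * norm u \<le> M / 2 * (norm s)\<^sup>2 * norm u"
    unfolding \<phi>_def u_def[symmetric] 
    by (simp add: u_def[symmetric] power2_norm_eq_inner[symmetric] power2_eq_square)
  moreover have "0 \<le> M / 2 * (norm s)\<^sup>2"
  proof (cases "s = 0")
    case False
    have "0 \<le> M * norm (x + s - x) * norm s"
      using lip[of "x + s" s] norm_ge_zero order_trans by blast
    then show ?thesis using False by (simp add: zero_le_mult_iff)
  qed simp
  ultimately show ?thesis
    unfolding u_def[symmetric] by (cases "u = 0") auto
qed

text \<open>One more integration: along the segment, \<open>F\<close> minus the cubic bound has a nonpositive derivative by
\<open>gradient_taylor_bound\<close>.\<close>

lemma cubic_taylor_upper_bound: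
  fixes F :: "'a::real_inner \<Rightarrow> real"
  assumes F: "\<And>z. (F has_derivative (\<lambda>h. G z \<bullet> h)) (at z)"
    and G: "\<And>z. (G has_derivative B z) (at z)"
    and lip: "\<And>z h. norm (B z h - B x h) \<le> M * norm (z - x) * norm h"
  shows "F (x + s) \<le> F x + G x \<bullet> s + 1/2 * (s \<bullet> B x s) + M / 6 * norm s ^ 3"
proof -
  have lin: "linear (B z)" for z using has_derivative_linear[OF G] .
  define \<phi> where "\<phi> \<tau> = F (x + \<tau> *\<^sub>R s) - F x - \<tau> * (G x \<bullet> s)
      - 1/2 * \<tau>\<^sup>2 * (s \<bullet> B x s) - M / 6 * norm s ^ 3 * \<tau> ^ 3" for \<tau>
  have der: "(\<phi> has_real_derivative
      (G (x + \<tau> *\<^sub>R s) - G x - \<tau> *\<^sub>R B x s) \<bullet> s - M / 2 * norm s ^ 3 * \<tau>\<^sup>2) (at \<tau>)" for \<tau>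
    unfolding \<phi>_def has_field_derivative_def
    by (rule derivative_eq_intros has_derivative_compose[OF _ F] refl
        | simp add: algebra_simps fun_eq_iff inner_commute)+
  have "\<phi> 1 \<le> \<phi> 0"
  proof (rule DERIV_nonpos_imp_nonincreasing[of 0 1 \<phi>])
    fix \<tau> :: real assume \<tau>: "0 \<le> \<tau>" "\<tau> \<le> 1"
    let ?d = "G (x + \<tau> *\<^sub>R s) - G x - \<tau> *\<^sub>R B x s"
    have "?d \<bullet> s \<le> norm ?d * norm s"
      by (rule norm_cauchy_schwarz)
    also have "norm ?d \<le> M / 2 * (norm (\<tau> *\<^sub>R s))\<^sup>2"
      using gradient_taylor_bound[of G B, OF G lip, of "\<tau> *\<^sub>R s"] by (simp add: linear_cmul[OF lin])
    then have "norm ?d * norm s \<le> M / 2 * (norm (\<tau> *\<^sub>R s))\<^sup>2 * norm s"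
      by (rule mult_right_mono) simp
    also have "\<dots> = M / 2 * norm s ^ 3 * \<tau>\<^sup>2"
      by (simp add: power_mult_distrib power3_eq_cube power2_eq_square)
    finally show "\<exists>y. (\<phi> has_real_derivative y) (at \<tau>) \<and> y \<le> 0"
      using der[of \<tau>] by (intro exI conjI) auto
  qed simp
  then show ?thesis
    unfolding \<phi>_def by simp
qed

section \<open>Global minimizers of the cubic model\<close>

lemma norm_matrix_vector_le_spectral_norm:
  "norm (A *v h) \<le> spectral_norm A * norm (h :: real^'n)" for A :: "real^'n^'m"
  unfolding spectral_norm_def by (rule onorm) (rule matrix_vector_mul_bounded_linear)

text \<open>An exact expansion around an arbitrary point, in place of the Taylor expansion of \<open>\<parallel>s\<parallel>\<^sup>3\<close>. With \<open>q = \<parallel>s + d\<parallel>\<close> and \<open>r = \<parallel>s\<parallel>\<close>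
it rests on \<open>q\<^sup>3 - r\<^sup>3 = 3/2 r (q\<^sup>2 - r\<^sup>2) + (q - r)\<^sup>2 (q + r/2)\<close>, where \<open>q\<^sup>2 - r\<^sup>2\<close> is quadratic in \<open>d\<close> and
the remainder vanishes whenever the step preserves the norm.\<close>

lemma cubic_model_add:
  assumes sym: "\<And>u v. u \<bullet> (H *v v) = (H *v u) \<bullet> v"
  shows "cubic_model g H M (s + d) - cubic_model g H M s =
    (g + H *v s + (M / 2 * norm s) *\<^sub>R s) \<bullet> d
    + 1/2 * (d \<bullet> (H *v d) + M / 2 * norm s * (norm d)\<^sup>2)
    + M / 6 * ((norm (s + d) - norm s)\<^sup>2 * (norm (s + d) + norm s / 2))"
proof -
  define q r where "q = norm (s + d)" and "r = norm s"
  have "q\<^sup>2 - r\<^sup>2 = 2 * (s \<bullet> d) + (norm d)\<^sup>2"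
    unfolding q_def r_def by (simp add: power2_norm_eq_inner algebra_simps inner_commute)
  moreover have "q ^ 3 - r ^ 3 = 3/2 * r * (q\<^sup>2 - r\<^sup>2) + (q - r)\<^sup>2 * (q + r / 2)"
    by (simp add: power2_eq_square power3_eq_cube field_simps)
  ultimately have "q ^ 3 = r ^ 3 + 3/2 * r * (2 * (s \<bullet> d) + (norm d)\<^sup>2) + (q - r)\<^sup>2 * (q + r / 2)"
    by simp
  moreover have "s \<bullet> (H *v d) = (H *v s) \<bullet> d" "d \<bullet> (H *v s) = (H *v s) \<bullet> d"
    using sym by (auto simp: inner_commute)
  ultimately show ?thesis
    unfolding cubic_model_def q_def[symmetric] r_def[symmetric]
    by (simp add: matrix_vector_right_distrib inner_add_left inner_add_right algebra_simps)
qed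

lemma zero_if_linear_le_quadratic:
  fixes a C :: real
  assumes "a \<ge> 0" and "\<And>t. t > 0 \<Longrightarrow> t \<le> 1 \<Longrightarrow> t * a \<le> t\<^sup>2 * C"
  shows "a = 0"
proof (rule ccontr)
  assume "a \<noteq> 0"
  then have a: "a > 0" using assms(1) by simp
  define t where "t = min 1 (a / (2 * (\<bar>C\<bar> + 1)))"
  have t: "t > 0" "t \<le> 1" unfolding t_def using a by auto
  have "t * a \<le> t * (t * C)" using assms(2)[OF t] by (simp add: power2_eq_square algebra_simps)
  then have "a \<le> t * C" using t by simp
  also have "\<dots> \<le> t * (\<bar>C\<bar> + 1)" using t by simp
  also have "\<dots> \<le> a / (2 * (\<bar>C\<bar> + 1)) * (\<bar>C\<bar> + 1)"
    unfolding t_def by (intro mult_right_mono) auto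
  also have "\<dots> = a / 2" by (simp add: field_simps add_nonneg_eq_0_iff)
  finally show False using a by simp
qed

text \<open>The optimality conditions of Nesterov and Polyak for a global minimizer. The second one is stronger
than positive semidefiniteness of the Hessian of the model at \<open>s\<close>: it controls \<open>H + M/2 \<parallel>s\<parallel> I\<close> without
the additional positive term along \<open>s\<close>, and is available because the minimizer is global.\<close>

lemma cubic_model_minimizer:
  assumes sym: "\<And>u v. u \<bullet> (H *v v) = (H *v u) \<bullet> v"
    and M: "M > 0"
    and min: "is_arg_min (cubic_model g H M) (\<lambda>_. True) s"
  shows "g + H *v s + (M / 2 * norm s) *\<^sub>R s = 0" (is "?w = 0")
    and "0 \<le> v \<bullet> (H *v v) + M / 2 * norm s * (norm v)\<^sup>2"
proof -
  define Q where "Q v = v \<bullet> (H *v v) + M / 2 * norm s * (norm v)\<^sup>2" for v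
  have Qscale: "Q (t *\<^sub>R v) = t\<^sup>2 * Q v" for t v
    unfolding Q_def by (simp add: matrix_vector_mult_scaleR power2_eq_square algebra_simps)
  have rem: "(norm (s + d) - norm s)\<^sup>2 * (norm (s + d) + norm s / 2)
      \<le> (norm d)\<^sup>2 * (norm d + 3/2 * norm s)" for d
  proof (rule mult_mono)
    have "\<bar>norm (s + d) - norm s\<bar> \<le> norm d"
      using norm_triangle_ineq3[of "s + d" s] by simp
    then show "(norm (s + d) - norm s)\<^sup>2 \<le> (norm d)\<^sup>2"
      by (metis abs_norm_cancel abs_le_square_iff)
    show "norm (s + d) + norm s / 2 \<le> norm d + 3/2 * norm s"
      using norm_triangle_ineq[of s d] by simp
  qed auto
  have incr: "0 \<le> ?w \<bullet> d + 1/2 * Q d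
      + M / 6 * ((norm (s + d) - norm s)\<^sup>2 * (norm (s + d) + norm s / 2))" for d
    using min cubic_model_add[OF sym, of g M s d]
    unfolding is_arg_min_def Q_def by (smt (verit))
  show w0: "?w = 0"
  proof -
    define w where "w = ?w"
    \<comment> \<open>Compare \<open>s\<close> with \<open>s - t w\<close>: the gain \<open>t \<parallel>w\<parallel>\<^sup>2\<close> is linear in \<open>t\<close>, all the rest is at most \<open>t\<^sup>2 C\<close>.\<close>
    define C where "C = 1/2 * \<bar>Q w\<bar> + M / 6 * ((norm w)\<^sup>2 * (norm w + 3/2 * norm s))"
    have "w \<bullet> w = 0"
    proof (rule zero_if_linear_le_quadratic[of _ C])
      fix t :: real assume t: "t > 0" "t \<le> 1"
      let ?d = "- (t *\<^sub>R w)"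
      have "(norm ?d)\<^sup>2 * (norm ?d + 3/2 * norm s) \<le> t\<^sup>2 * ((norm w)\<^sup>2 * (norm w + 3/2 * norm s))"
      proof -
        have "norm ?d \<le> norm w" using t by (simp add: mult_left_le_one_le)
        then have "(norm ?d)\<^sup>2 * (norm ?d + 3/2 * norm s) \<le> (norm ?d)\<^sup>2 * (norm w + 3/2 * norm s)"
          by (intro mult_left_mono) auto
        then show ?thesis by (simp add: power_mult_distrib mult.assoc)
      qed
      then have "(norm (s + ?d) - norm s)\<^sup>2 * (norm (s + ?d) + norm s / 2)
          \<le> t\<^sup>2 * ((norm w)\<^sup>2 * (norm w + 3/2 * norm s))"
        using rem[of ?d] by linarith
      then have "M / 6 * ((norm (s + ?d) - norm s)\<^sup>2 * (norm (s + ?d) + norm s / 2))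
          \<le> M / 6 * (t\<^sup>2 * ((norm w)\<^sup>2 * (norm w + 3/2 * norm s)))"
        using M by (intro mult_left_mono) auto
      moreover have "Q ?d = t\<^sup>2 * Q w" using Qscale[of "-t" w] by simp
      moreover have "t\<^sup>2 * Q w \<le> t\<^sup>2 * \<bar>Q w\<bar>" by (intro mult_left_mono) auto
      ultimately show "t * (w \<bullet> w) \<le> t\<^sup>2 * C"
        using incr[of ?d] unfolding w_def[symmetric] C_def by (simp add: algebra_simps)
    qed simp
    then show ?thesis unfolding w_def by simp
  qed
  show "0 \<le> v \<bullet> (H *v v) + M / 2 * norm s * (norm v)\<^sup>2"
  proof (cases "v \<bullet> s = 0")
    case False
    then have v: "v \<noteq> 0" by auto
    \<comment> \<open>Reflecting \<open>s\<close> in the hyperplane orthogonal to \<open>v\<close> preserves the norm, so the remainder vanishes.\<close>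
    define t where "t = - 2 * (v \<bullet> s) / (norm v)\<^sup>2"
    have t: "t \<noteq> 0" using False v unfolding t_def by simp
    have "(norm (s + t *\<^sub>R v))\<^sup>2 = (norm s)\<^sup>2 + t * (2 * (v \<bullet> s) + t * (norm v)\<^sup>2)"
      by (simp add: power2_norm_eq_inner algebra_simps inner_commute)
    also have "\<dots> = (norm s)\<^sup>2" using v unfolding t_def by simp
    finally have "norm (s + t *\<^sub>R v) = norm s" by simp
    then have "0 \<le> t\<^sup>2 * Q v" using incr[of "t *\<^sub>R v"] w0 by (simp add: Qscale)
    then show ?thesis using t unfolding Q_def by (simp add: zero_le_mult_iff)
  next
    case True
    \<comment> \<open>For \<open>v\<close> orthogonal to \<open>s\<close> the norm changes only to second order, so the remainder is of order \<open>t\<^sup>3\<close>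
        and cannot compensate a negative \<open>t\<^sup>2 Q v\<close>. Working with the negative part \<open>A\<close> of \<open>Q v\<close> gives the
        nonnegative quantity that \<open>zero_if_linear_le_quadratic\<close> asks for.\<close>
    define A where "A = max 0 (- Q v)"
    have "A = 0"
    proof (rule zero_if_linear_le_quadratic[of _ "M / 3 * norm v ^ 3"])
      fix t :: real assume t: "t > 0" "t \<le> 1"
      define q where "q = norm (s + t *\<^sub>R v)"
      define r where "r = norm s"
      have pos: "q \<ge> 0" "r \<ge> 0" unfolding q_def r_def by auto
      have sq: "q\<^sup>2 - r\<^sup>2 = t\<^sup>2 * (norm v)\<^sup>2"
        unfolding q_def r_def using True
        by (simp add: power2_norm_eq_inner inner_add_left inner_add_right inner_commute)
          (simp add: power2_eq_square)
      then have "r\<^sup>2 \<le> q\<^sup>2" by (smt (verit) mult_nonneg_nonneg zero_le_power2)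
      then have qr: "r \<le> q" using pos by (meson power2_le_imp_le)
      have "q - r \<le> t * norm v"
        unfolding q_def r_def using norm_triangle_ineq[of s "t *\<^sub>R v"] t by simp
      have "(q - r)\<^sup>2 * (q + r / 2) \<le> (q - r)\<^sup>2 * (q + r)"
        using pos by (intro mult_left_mono) auto
      also have "\<dots> = (q - r) * (q\<^sup>2 - r\<^sup>2)"
        by (simp add: power2_eq_square algebra_simps)
      also have "\<dots> \<le> (t * norm v) * (t\<^sup>2 * (norm v)\<^sup>2)"
        unfolding sq using \<open>q - r \<le> t * norm v\<close> by (intro mult_right_mono) auto
      also have "\<dots> = t\<^sup>2 * (t * norm v ^ 3)"
        by (simp add: power2_eq_square power3_eq_cube)
      finally have "M / 6 * ((q - r)\<^sup>2 * (q + r / 2)) \<le> M / 6 * (t\<^sup>2 * (t * norm v ^ 3))"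
        using M by (intro mult_left_mono) auto
      then have "0 \<le> t\<^sup>2 * (1/2 * Q v + M / 6 * (t * norm v ^ 3))"
        using incr[of "t *\<^sub>R v", unfolded w0] unfolding q_def[symmetric] r_def[symmetric]
        by (simp add: Qscale algebra_simps)
      then have "0 \<le> 1/2 * Q v + M / 6 * (t * norm v ^ 3)"
        using t by (simp add: zero_le_mult_iff)
      then have "- Q v \<le> t * (M / 3 * norm v ^ 3)"
        by (simp add: field_simps)
      moreover have "0 \<le> t * (M / 3 * norm v ^ 3)" using t M by simp
      ultimately have "A \<le> t * (M / 3 * norm v ^ 3)" unfolding A_def by simp
      then show "t * A \<le> t\<^sup>2 * (M / 3 * norm v ^ 3)"
        using t by (simp add: power2_eq_square mult_left_mono mult.assoc)
    qed (simp add: A_def)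
    then show ?thesis unfolding A_def Q_def by linarith
  qed
qed

section \<open>A cubic Newton step with inexact data\<close>

text \<open>One step \<open>s\<close> from \<open>x\<close>, computed from inexact first- and second-order data of \<open>F\<close>. The parameter \<open>e\<close> is the
natural length scale: tolerances \<open>\<epsilon>\<close> for the gradient and \<open>sqrt (M \<epsilon>)\<close> for the Hessian are \<open>M e\<^sup>2\<close> and
\<open>M e\<close> with \<open>e = sqrt (\<epsilon> / M)\<close>, and all estimates become homogeneous in \<open>e\<close> and \<open>\<parallel>s\<parallel>\<close>.\<close>

locale inexact_cubic_step =
  fixes F :: "real^'n \<Rightarrow> real" and G :: "real^'n \<Rightarrow> real^'n" and B :: "real^'n \<Rightarrow> real^'n \<Rightarrow> real^'n"
    and M e :: real and x s g :: "real^'n" and H :: "real^'n^'n"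
  assumes F: "\<And>z. (F has_derivative (\<lambda>h. G z \<bullet> h)) (at z)"
    and G: "\<And>z. (G has_derivative B z) (at z)"
    and lip: "\<And>z w h. norm (B z h - B w h) \<le> M * norm (z - w) * norm h"
    and M: "M > 0" and e: "e > 0"
    and sym: "\<And>u v. u \<bullet> (H *v v) = (H *v u) \<bullet> v"
    and min: "is_arg_min (cubic_model g H M) (\<lambda>_. True) s"
    and grad_error: "norm (G x - g) \<le> M * e\<^sup>2 / 192"
    and hess_error: "\<And>h. norm (B x h - H *v h) \<le> M * e / 48 * norm h"
begin

lemma first_order: "g + H *v s + (M / 2 * norm s) *\<^sub>R s = 0"
  using cubic_model_minimizer(1)[OF sym M min] .

lemma second_order: "0 \<le> v \<bullet> (H *v v) + M / 2 * norm s * (norm v)\<^sup>2"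
  using cubic_model_minimizer(2)[OF sym M min] .

lemma curvature_error: "\<bar>v \<bullet> B x v - v \<bullet> (H *v v)\<bar> \<le> M * e / 48 * (norm v)\<^sup>2"
proof -
  have "\<bar>v \<bullet> (B x v - H *v v)\<bar> \<le> norm v * norm (B x v - H *v v)"
    by (rule Cauchy_Schwarz_ineq2)
  also have "\<dots> \<le> norm v * (M * e / 48 * norm v)"
    by (intro mult_left_mono hess_error) simp
  finally show ?thesis
    by (simp add: inner_diff_right power2_eq_square mult_ac)
qed

text \<open>The optimality conditions bound the quadratic part of the model by \<open>- M/4 r\<^sup>3\<close> with \<open>r = \<parallel>s\<parallel>\<close>, and the Taylor
remainder costs \<open>M/6 r\<^sup>3\<close>. Since \<open>e < 2 r\<close>, each of the two error terms costs at most \<open>M/48 r\<^sup>3\<close>, which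
leaves a decrease of \<open>M/24 r\<^sup>3 > M/192 e\<^sup>3\<close>.\<close>

lemma long_step_decreases:
  assumes long: "norm s > e / 2"
  shows "F (x + s) < F x - M * e ^ 3 / 192"
proof -
  define r where "r = norm s"
  have r: "e < 2 * r" "r > 0" using long e unfolding r_def by auto
  have "F (x + s) \<le> F x + G x \<bullet> s + 1/2 * (s \<bullet> B x s) + M / 6 * r ^ 3"
    unfolding r_def by (rule cubic_taylor_upper_bound[OF F G lip])
  moreover have "g \<bullet> s + s \<bullet> (H *v s) + M / 2 * r ^ 3 = 0"
  proof -
    have "(g + H *v s + (M / 2 * norm s) *\<^sub>R s) \<bullet> s = 0"
      unfolding first_order by simp
    then show ?thesis
      by (simp add: r_def inner_add_right inner_commute[of _ s] power3_eq_cube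
          dot_square_norm power2_eq_square mult.assoc)
  qed
  moreover have "0 \<le> s \<bullet> (H *v s) + M / 2 * r ^ 3"
    using second_order[of s] by (simp add: r_def power3_eq_cube power2_eq_square mult_ac)
  moreover have "G x \<bullet> s - g \<bullet> s \<le> M * r ^ 3 / 48"
  proof -
    have "(G x - g) \<bullet> s \<le> norm (G x - g) * r"
      unfolding r_def by (rule norm_cauchy_schwarz)
    also have "\<dots> \<le> M * e\<^sup>2 / 192 * r"
      using r by (intro mult_right_mono grad_error) simp
    also have "\<dots> \<le> M * (2 * r)\<^sup>2 / 192 * r"
      using r M e by (intro mult_right_mono divide_right_mono mult_left_mono power_mono) auto
    finally show ?thesis
      by (simp add: inner_diff_left power2_eq_square power3_eq_cube mult_ac)
  qed
  moreover have "s \<bullet> B x s - s \<bullet> (H *v s) \<le> M * r ^ 3 / 24"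
  proof -
    have "s \<bullet> B x s - s \<bullet> (H *v s) \<le> M * e / 48 * r\<^sup>2"
      using abs_le_D1[OF curvature_error[of s]] unfolding r_def by simp
    also have "\<dots> \<le> M * (2 * r) / 48 * r\<^sup>2"
      using r M by (intro mult_right_mono divide_right_mono mult_left_mono) auto
    finally show ?thesis
      by (simp add: power2_eq_square power3_eq_cube mult_ac)
  qed
  ultimately have "F (x + s) \<le> F x - M * r ^ 3 / 24"
    by (simp add: field_simps)
  moreover have "e ^ 3 < (2 * r) ^ 3"
    using r e by (intro power_strict_mono) auto
  then have "M * e ^ 3 / 192 < M * r ^ 3 / 24"
    using M by (simp add: power_mult_distrib)
  ultimately show ?thesis by linarith
qed

text \<open>The gradient at \<open>x + s\<close> splits into the Taylor remainder, the two data errors and the model gradient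
\<open>g + H s\<close>, whose norm is \<open>M/2 r\<^sup>2\<close> by optimality. With \<open>r \<le> e/2\<close> they add up to at most
\<open>(1/8 + 1/192 + 1/96 + 1/8) M e\<^sup>2\<close>.\<close>

lemma short_step_gradient:
  assumes short: "norm s \<le> e / 2"
  shows "norm (G (x + s)) \<le> M * e\<^sup>2"
proof -
  define r where "r = norm s"
  have r: "0 \<le> r" "r \<le> e / 2" using short unfolding r_def by auto
  have r2: "r\<^sup>2 \<le> e\<^sup>2 / 4"
    using power_mono[OF r(2) r(1), of 2] by (simp add: power_divide)
  have "norm (G (x + s) - G x - B x s) \<le> M / 2 * r\<^sup>2"
    unfolding r_def by (rule gradient_taylor_bound[of G B, OF G lip])
  moreover have "norm (g + H *v s) = M / 2 * r\<^sup>2"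
  proof -
    have "g + H *v s = - ((M / 2 * norm s) *\<^sub>R s)"
      using first_order by (simp add: add_eq_0_iff2)
    then show ?thesis using M by (simp add: r_def power2_eq_square)
  qed
  moreover have "norm (B x s - H *v s) \<le> M * e / 48 * (e / 2)"
  proof -
    have "norm (B x s - H *v s) \<le> M * e / 48 * r" unfolding r_def by (rule hess_error)
    also have "\<dots> \<le> M * e / 48 * (e / 2)" using r M e by (intro mult_left_mono) auto
    finally show ?thesis .
  qed
  moreover have "G (x + s) = (G (x + s) - G x - B x s) + (G x - g) + (B x s - H *v s) + (g + H *v s)"
    by simp
  then have "norm (G (x + s)) \<le> norm (G (x + s) - G x - B x s) + norm (G x - g)
      + norm (B x s - H *v s) + norm (g + H *v s)"
    by (metis (no_types, lifting) add_mono norm_triangle_ineq norm_triangle_le order_refl)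
  moreover have "M * r\<^sup>2 \<le> M * (e\<^sup>2 / 4)" using r2 M by (intro mult_left_mono) auto
  moreover have "M * e\<^sup>2 \<ge> 0" using M by simp
  ultimately show ?thesis
    using grad_error by (simp add: power2_eq_square)
qed

text \<open>Moving from \<open>x\<close> to \<open>x + s\<close>, replacing the Hessian by \<open>H\<close>, and the second optimality condition lose
\<open>M r\<close>, \<open>M e / 48\<close> and \<open>M r / 2\<close> of curvature, which for \<open>r \<le> e/2\<close> is less than \<open>M e\<close> in total.\<close>

lemma short_step_curvature:
  assumes short: "norm s \<le> e / 2"
  shows "- (M * e) * (norm v)\<^sup>2 \<le> v \<bullet> B (x + s) v"
proof -
  have "\<bar>v \<bullet> (B (x + s) v - B x v)\<bar> \<le> norm v * norm (B (x + s) v - B x v)"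
    by (rule Cauchy_Schwarz_ineq2)
  also have "\<dots> \<le> norm v * (M * norm (x + s - x) * norm v)"
    by (intro mult_left_mono lip) simp
  also have "\<dots> = M * norm s * (norm v)\<^sup>2"
    by (simp add: power2_eq_square)
  finally have "v \<bullet> B x v - M * norm s * (norm v)\<^sup>2 \<le> v \<bullet> B (x + s) v"
    by (simp add: inner_diff_right abs_le_iff)
  moreover have "M * norm s * (norm v)\<^sup>2 \<le> M * (e / 2) * (norm v)\<^sup>2"
    using short M by (intro mult_right_mono mult_left_mono) auto
  moreover have "0 \<le> v \<bullet> (H *v v) + 1/2 * (M * norm s * (norm v)\<^sup>2)"
    using second_order[of v] by simp
  moreover have "v \<bullet> (H *v v) - 1/48 * (M * e * (norm v)\<^sup>2) \<le> v \<bullet> B x v"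
    using abs_le_D2[OF curvature_error[of v]] by simp
  moreover have "0 \<le> M * e * (norm v)\<^sup>2" using M e by simp
  ultimately show ?thesis by simp
qed

end

section \<open>Derivatives of a smooth function that is strongly concave in its second argument\<close>

locale smooth_strongly_concave =
  fixes f :: "(real^'n) \<times> (real^'m) \<Rightarrow> real" and L \<rho> \<mu> :: real
  assumes pos: "L > 0" "\<rho> > 0" "\<mu> > 0"
    and twice_diff: "\<And>z. twice_differentiable_at f z"
    and gradient_lipschitz: "\<And>u u' v v'. (norm (grad f (u, v) - grad f (u', v')))\<^sup>2
               \<le> L\<^sup>2 * ((norm (u - u'))\<^sup>2 + (norm (v - v'))\<^sup>2)"
    and hessian_lipschitz: "\<And>u u' v v'. (onorm (\<lambda>h. hess_op f (u, v) h - hess_op f (u', v') h))\<^sup>2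
               \<le> \<rho>\<^sup>2 * ((norm (u - u'))\<^sup>2 + (norm (v - v'))\<^sup>2)"
    and strongly_concave: "\<And>u v v'. f (u, v)
               \<le> f (u, v') + grad_y f u v' \<bullet> (v - v') - \<mu> / 2 * (norm (v - v'))\<^sup>2"
begin

lemma f_derivative: "(f has_derivative (\<lambda>h. grad f z \<bullet> h)) (at z)"
  using twice_diff[of z] eventually_nhds_x_imp_x unfolding twice_differentiable_at_def
  by (intro has_derivative_grad) blast

lemma grad_derivative: "(grad f has_derivative hess_op f z) (at z)"
  using twice_diff[of z] frechet_derivative_works
  unfolding twice_differentiable_at_def hess_op_def by blast

lemma linear_hess_op: "linear (hess_op f z)"
  using has_derivative_linear[OF grad_derivative] .

lemma hess_op_symmetric: "hess_op f z h \<bullet> k = h \<bullet> hess_op f z k"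
  by (rule derivative_of_gradient_symmetric[OF f_derivative grad_derivative])

lemma grad_lipschitz_norm: "norm (grad f z - grad f z') \<le> L * norm (z - z')"
proof -
  have "(norm (grad f z - grad f z'))\<^sup>2 \<le> L\<^sup>2 * ((norm (fst z - fst z'))\<^sup>2 + (norm (snd z - snd z'))\<^sup>2)"
    using gradient_lipschitz[of "fst z" "snd z" "fst z'" "snd z'"] by simp
  also have "\<dots> = (L * norm (z - z'))\<^sup>2"
    by (simp add: power_mult_distrib norm_prod_def)
  finally show ?thesis
    by (rule power2_le_imp_le) (use pos in simp)
qed

lemma hess_op_bound: "norm (hess_op f z h) \<le> L * norm h"
proof (rule tendsto_upperbound)
  show "((\<lambda>t. norm ((grad f (z + t *\<^sub>R h) - grad f z) /\<^sub>R t)) \<longlongrightarrow> norm (hess_op f z h)) (at_right 0)"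
    by (intro tendsto_norm directional_derivative_limit grad_derivative)
  show "\<forall>\<^sub>F t in at_right 0. norm ((grad f (z + t *\<^sub>R h) - grad f z) /\<^sub>R t) \<le> L * norm h"
  proof (rule eventually_at_right_less[THEN eventually_mono])
    fix t :: real assume t: "0 < t"
    have "norm (grad f (z + t *\<^sub>R h) - grad f z) \<le> L * (t * norm h)"
      using grad_lipschitz_norm[of "z + t *\<^sub>R h" z] t by simp
    then show "norm ((grad f (z + t *\<^sub>R h) - grad f z) /\<^sub>R t) \<le> L * norm h"
      unfolding norm_scaleR using t by (simp add: field_simps)
  qed
qed simp

lemma hess_op_lipschitz:
  "norm (hess_op f z h - hess_op f z' h) \<le> \<rho> * norm (z - z') * norm h"
proof -
  have bl: "bounded_linear (\<lambda>h. hess_op f z h - hess_op f z' h)"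
    by (intro bounded_linear_sub) (simp_all add: linear_conv_bounded_linear[symmetric] linear_hess_op)
  have "(onorm (\<lambda>h. hess_op f z h - hess_op f z' h))\<^sup>2 \<le>
      \<rho>\<^sup>2 * ((norm (fst z - fst z'))\<^sup>2 + (norm (snd z - snd z'))\<^sup>2)"
    using hessian_lipschitz[of "fst z" "snd z" "fst z'" "snd z'"] by simp
  also have "\<dots> = (\<rho> * norm (z - z'))\<^sup>2"
    by (simp add: power_mult_distrib norm_prod_def)
  finally have "onorm (\<lambda>h. hess_op f z h - hess_op f z' h) \<le> \<rho> * norm (z - z')"
    by (rule power2_le_imp_le) (use pos in simp)
  then show ?thesis
    using onorm[OF bl, of h] by (meson mult_right_mono norm_ge_zero order_trans)
qed

lemma grad_x_eq: "grad_x f u v = fst (grad f (u, v))"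
  unfolding grad_x_def
proof (rule grad_eqI)
  have "((\<lambda>u. f (u, v)) has_derivative (\<lambda>h. grad f (u, v) \<bullet> (h, 0))) (at u)"
    by (rule has_derivative_compose[OF _ f_derivative]) (auto intro!: derivative_eq_intros)
  then show "((\<lambda>u. f (u, v)) has_derivative (\<lambda>h. fst (grad f (u, v)) \<bullet> h)) (at u)"
    by (simp add: inner_prod_def)
qed

lemma f_section_derivative:
  "((\<lambda>v. f (u, v)) has_derivative (\<lambda>h. snd (grad f (u, v)) \<bullet> h)) (at v)"
proof -
  have "((\<lambda>v. f (u, v)) has_derivative (\<lambda>h. grad f (u, v) \<bullet> (0, h))) (at v)"
    by (rule has_derivative_compose[OF _ f_derivative]) (auto intro!: derivative_eq_intros)
  then show ?thesis by (simp add: inner_prod_def)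
qed

lemma grad_y_eq: "grad_y f u v = snd (grad f (u, v))"
  unfolding grad_y_def by (rule grad_eqI[OF f_section_derivative])

lemma
  shows hess_xx_mult: "hess_xx f u v *v h = fst (hess_op f (u, v) (h, 0))"
    and hess_yx_mult: "hess_yx f u v *v h = snd (hess_op f (u, v) (h, 0))"
    and hess_xy_mult: "hess_xy f u v *v w = fst (hess_op f (u, v) (0, w))"
    and hess_yy_mult: "hess_yy f u v *v w = snd (hess_op f (u, v) (0, w))"
proof -
  have x: "((\<lambda>u. grad f (u, v)) has_derivative (\<lambda>h. hess_op f (u, v) (h, 0))) (at u)"
    by (rule has_derivative_compose[OF _ grad_derivative]) (auto intro!: derivative_eq_intros)
  have y: "((\<lambda>v. grad f (u, v)) has_derivative (\<lambda>h. hess_op f (u, v) (0, h))) (at v)"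
    by (rule has_derivative_compose[OF _ grad_derivative]) (auto intro!: derivative_eq_intros)
  show "hess_xx f u v *v h = fst (hess_op f (u, v) (h, 0))"
    unfolding hess_xx_def grad_x_eq by (rule jacobian_mult[OF has_derivative_fst[OF x]])
  show "hess_yx f u v *v h = snd (hess_op f (u, v) (h, 0))"
    unfolding hess_yx_def grad_y_eq by (rule jacobian_mult[OF has_derivative_snd[OF x]])
  show "hess_xy f u v *v w = fst (hess_op f (u, v) (0, w))"
    unfolding hess_xy_def grad_x_eq by (rule jacobian_mult[OF has_derivative_fst[OF y]])
  show "hess_yy f u v *v w = snd (hess_op f (u, v) (0, w))"
    unfolding hess_yy_def grad_y_eq by (rule jacobian_mult[OF has_derivative_snd[OF y]])
qed

lemma grad_y_monotone:
  "(snd (grad f (u, v)) - snd (grad f (u, v'))) \<bullet> (v - v') \<le> - \<mu> * (norm (v - v'))\<^sup>2"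
  using strongly_concave[of u v v'] strongly_concave[of u v' v]
  by (simp add: grad_y_eq norm_minus_commute inner_diff_left inner_diff_right)

lemma hess_yy_negative: "snd (hess_op f z (0, w)) \<bullet> w \<le> - \<mu> * (norm w)\<^sup>2"
proof (rule tendsto_upperbound)
  let ?q = "\<lambda>t. (grad f (z + t *\<^sub>R (0, w)) - grad f z) /\<^sub>R t"
  show "((\<lambda>t. snd (?q t) \<bullet> w) \<longlongrightarrow> snd (hess_op f z (0, w)) \<bullet> w) (at_right 0)"
    by (intro tendsto_inner tendsto_snd tendsto_const directional_derivative_limit grad_derivative)
  show "\<forall>\<^sub>F t in at_right 0. snd (?q t) \<bullet> w \<le> - \<mu> * (norm w)\<^sup>2"
  proof (rule eventually_at_right_less[THEN eventually_mono])
    fix t :: real assume t: "0 < t"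
    obtain u v where z: "z = (u, v)" by force
    have "t * ((snd (grad f (u, v + t *\<^sub>R w)) - snd (grad f (u, v))) \<bullet> w) \<le> t * (- \<mu> * t * (norm w)\<^sup>2)"
      using grad_y_monotone[of u "v + t *\<^sub>R w" v] by (simp add: power_mult_distrib power2_eq_square mult_ac)
    then have "(snd (grad f (u, v + t *\<^sub>R w)) - snd (grad f (u, v))) \<bullet> w \<le> - \<mu> * t * (norm w)\<^sup>2"
      by (rule mult_left_le_imp_le) (rule t)
    then show "snd (?q t) \<bullet> w \<le> - \<mu> * (norm w)\<^sup>2"
      unfolding snd_scaleR inner_scaleR_left using t by (simp add: z field_simps)
  qed
qed simp

text \<open>The Hessian has norm at most \<open>L\<close> and curvature at most \<open>- \<mu>\<close> in the \<open>y\<close>-directions, of which there is at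
least one. So the condition number is at least one, which lets \<open>1 + \<kappa>\<^sup>2\<close> be absorbed into \<open>2 \<kappa>\<^sup>2\<close> later on.\<close>

lemma mu_le_L: "\<mu> \<le> L"
proof -
  obtain w :: "real^'m" where w: "norm w = 1" using vector_choose_size[of 1] by auto
  have "\<mu> \<le> - (snd (hess_op f 0 (0, w)) \<bullet> w)"
    using hess_yy_negative[of 0 w] w by simp
  also have "\<dots> \<le> norm (snd (hess_op f 0 (0, w)))"
    using Cauchy_Schwarz_ineq2[of "snd (hess_op f 0 (0, w))" w] w by simp
  also have "\<dots> \<le> norm (hess_op f 0 (0, w))" 
    by (rule norm_snd_le_norm)
  also have "\<dots> \<le> L" using hess_op_bound[of 0 "(0, w)"] w by (simp add: norm_Pair)
  finally show ?thesis .
qed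

section \<open>The Schur complement of the Hessian\<close>

text \<open>To first order, moving \<open>x\<close> by \<open>h\<close> and \<open>y\<close> by \<open>response z h\<close> leaves the \<open>y\<close>-gradient at \<open>z\<close> unchanged; at a
maximizer it is the derivative of the maximizer.\<close>

definition response :: "(real^'n) \<times> (real^'m) \<Rightarrow> real^'n \<Rightarrow> real^'m" where
  "response z h = - (matrix_inv (hess_yy f (fst z) (snd z)) *v (hess_yx f (fst z) (snd z) *v h))"

lemma hess_yy_injective: "\<mu> * norm w \<le> norm (snd (hess_op f z (0, w)))"
proof -
  have "\<mu> * (norm w)\<^sup>2 \<le> norm (snd (hess_op f z (0, w))) * norm w"
    using hess_yy_negative[of z w] Cauchy_Schwarz_ineq2[of "snd (hess_op f z (0, w))" w] by linarith
  then show ?thesis by (cases "w = 0") (auto simp: power2_eq_square)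
qed

lemma response_equation: "snd (hess_op f z (h, response z h)) = 0"
proof -
  obtain u v where z: "z = (u, v)" by force
  let ?A = "hess_yy f u v"
  have "w = 0" if "?A *v w = 0" for w
    using hess_yy_injective[of w z] that pos by (simp add: hess_yy_mult z mult_le_0_iff)
  then have "invertible ?A"
    using matrix_left_invertible_ker[of ?A] invertible_left_inverse[of ?A] by blast
  then have "?A ** matrix_inv ?A = mat 1"
    unfolding invertible_def matrix_inv_def by (rule someI2_ex) blast
  then have "?A *v (matrix_inv ?A *v y) = y" for y
    by (simp add: matrix_vector_mul_assoc)
  then have "?A *v response z h = - (hess_yx f u v *v h)"
    unfolding response_def z by (simp add: linear_neg[OF matrix_vector_mul_linear])
  moreover have "hess_op f z (h, response z h) = hess_op f z (h, 0) + hess_op f z (0, response z h)"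
    by (simp add: linear_add[OF linear_hess_op, symmetric])
  ultimately show ?thesis
    by (simp add: z hess_yy_mult hess_yx_mult)
qed

lemma linear_response: "linear (response z)"
  unfolding response_def
  by (rule linearI) (simp_all add: matrix_vector_right_distrib matrix_vector_mult_scaleR)

lemma schur_hess_mult:
  "schur_hess f u v *v h = fst (hess_op f (u, v) (h, response (u, v) h))"
proof -
  have "hess_op f (u, v) (h, response (u, v) h) = hess_op f (u, v) (h, 0) + hess_op f (u, v) (0, response (u, v) h)"
    by (simp add: linear_add[OF linear_hess_op, symmetric])
  then show ?thesis
    unfolding schur_hess_def
    by (simp add: matrix_vector_mult_diff_rdistrib matrix_vector_mul_assoc[symmetric] response_def
        hess_xx_mult hess_xy_mult[symmetric] linear_neg[OF matrix_vector_mul_linear])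
qed

text \<open>The key formula: since the second component of \<open>hess_op f z (h, response z h)\<close> vanishes, the vector \<open>w\<close> is
arbitrary, and can be adapted to any other point.\<close>

lemma schur_hess_bilinear:
  "k \<bullet> (schur_hess f u v *v h) = (k, w) \<bullet> hess_op f (u, v) (h, response (u, v) h)"
  by (simp add: schur_hess_mult inner_prod_def response_equation)

lemma schur_hess_symmetric: "k \<bullet> (schur_hess f u v *v h) = (schur_hess f u v *v k) \<bullet> h"
proof -
  have "k \<bullet> (schur_hess f u v *v h) = (k, response (u, v) k) \<bullet> hess_op f (u, v) (h, response (u, v) h)"
    by (rule schur_hess_bilinear)
  also have "\<dots> = (h, response (u, v) h) \<bullet> hess_op f (u, v) (k, response (u, v) k)"
    by (subst inner_commute) (rule hess_op_symmetric)
  also have "\<dots> = h \<bullet> (schur_hess f u v *v k)"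
    by (rule schur_hess_bilinear[symmetric])
  finally show ?thesis by (simp add: inner_commute)
qed

lemma response_bound: "norm (response z h) \<le> L / \<mu> * norm h"
proof -
  let ?w = "response z h"
  have "hess_op f z (0, ?w) = hess_op f z (h, ?w) - hess_op f z (h, 0)"
    by (simp add: linear_diff[OF linear_hess_op, symmetric])
  then have "snd (hess_op f z (0, ?w)) = - snd (hess_op f z (h, 0))"
    by (simp add: response_equation)
  then have "\<mu> * norm ?w \<le> norm (snd (hess_op f z (h, 0)))"
    using hess_yy_injective[of ?w z] by simp
  also have "\<dots> \<le> norm (hess_op f z (h, 0))"
    by (rule norm_snd_le_norm)
  also have "\<dots> \<le> L * norm h"
    using hess_op_bound[of z "(h, 0)"] by (simp add: norm_Pair)
  finally show ?thesis using pos by (simp add: field_simps)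
qed

text \<open>For the two bilinear forms choose in \<open>schur_hess_bilinear\<close> the free vectors so that both are evaluated on
the same pair: \<open>a\<close> takes its response from the first point, \<open>b\<close> from the second. The difference is then
a difference of full Hessians, and no inverse matrices have to be compared.\<close>

lemma schur_hess_lipschitz:
  "norm (schur_hess f u v *v h - schur_hess f u' v' *v h)
     \<le> \<rho> * (1 + (L / \<mu>)\<^sup>2) * norm ((u, v) - (u', v')) * norm h"
proof -
  define k where "k = schur_hess f u v *v h - schur_hess f u' v' *v h"
  define a where "a = (h, response (u, v) h)"
  define b where "b = (k, response (u', v') k)"
  define \<kappa> where "\<kappa> = L / \<mu>"
  have na: "norm a \<le> sqrt (1 + \<kappa>\<^sup>2) * norm h" and nb: "norm b \<le> sqrt (1 + \<kappa>\<^sup>2) * norm k"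
    unfolding a_def b_def \<kappa>_def
    by (intro norm_Pair_le_sqrt response_bound)+
  have "k \<bullet> (schur_hess f u v *v h) = b \<bullet> hess_op f (u, v) a"
    unfolding a_def b_def by (rule schur_hess_bilinear)
  moreover have "k \<bullet> (schur_hess f u' v' *v h) = b \<bullet> hess_op f (u', v') a"
  proof -
    have "k \<bullet> (schur_hess f u' v' *v h) = h \<bullet> (schur_hess f u' v' *v k)"
      using schur_hess_symmetric[of k] by (simp add: inner_commute)
    also have "\<dots> = a \<bullet> hess_op f (u', v') b"
      unfolding a_def b_def by (rule schur_hess_bilinear)
    also have "\<dots> = b \<bullet> hess_op f (u', v') a"
      by (subst inner_commute) (rule hess_op_symmetric)
    finally show ?thesis .
  qed
  moreover have "norm k * norm k = k \<bullet> (schur_hess f u v *v h - schur_hess f u' v' *v h)"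
    unfolding k_def[symmetric] by (simp add: dot_square_norm power2_eq_square)
  ultimately have "norm k * norm k = b \<bullet> (hess_op f (u, v) a - hess_op f (u', v') a)"
    by (simp only: inner_diff_right)
  also have "\<dots> \<le> norm b * norm (hess_op f (u, v) a - hess_op f (u', v') a)"
    by (rule norm_cauchy_schwarz)
  also have "\<dots> \<le> norm b * (\<rho> * norm ((u, v) - (u', v')) * norm a)"
    by (intro mult_left_mono hess_op_lipschitz) simp
  also have "\<dots> \<le> (sqrt (1 + \<kappa>\<^sup>2) * norm k) * (\<rho> * norm ((u, v) - (u', v')) * (sqrt (1 + \<kappa>\<^sup>2) * norm h))"
    using pos by (intro mult_mono nb mult_left_mono na) auto
  also have "\<dots> = (sqrt (1 + \<kappa>\<^sup>2) * sqrt (1 + \<kappa>\<^sup>2)) * (\<rho> * norm ((u, v) - (u', v')) * norm h) * norm k"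
    by (simp only: mult_ac)
  also have "sqrt (1 + \<kappa>\<^sup>2) * sqrt (1 + \<kappa>\<^sup>2) = 1 + \<kappa>\<^sup>2" by simp
  finally have "norm k * norm k \<le> (1 + \<kappa>\<^sup>2) * (\<rho> * norm ((u, v) - (u', v')) * norm h) * norm k" .
  moreover have "0 \<le> (1 + \<kappa>\<^sup>2) * (\<rho> * norm ((u, v) - (u', v')) * norm h)"
    using pos by simp
  ultimately have "norm k \<le> (1 + \<kappa>\<^sup>2) * (\<rho> * norm ((u, v) - (u', v')) * norm h)"
    by (cases "k = 0") auto
  then show ?thesis unfolding k_def \<kappa>_def by (simp add: mult_ac)
qed

section \<open>The maximizer and the primal function\<close>

definition maximizer :: "real^'n \<Rightarrow> real^'m" where
  "maximizer u = (SOME v. \<forall>v'. f (u, v') \<le> f (u, v))"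

text \<open>Strong concavity bounds \<open>f (u, w)\<close> by \<open>f (u, 0) + \<parallel>g\<parallel> \<parallel>w\<parallel> - \<mu>/2 \<parallel>w\<parallel>\<^sup>2\<close>, so outside the ball of radius
\<open>2 \<parallel>g\<parallel> / \<mu>\<close> no value exceeds that at the centre, and compactness of the ball gives a maximizer.\<close>

lemma maximizer_max: "f (u, v') \<le> f (u, maximizer u)"
proof -
  define g where "g = grad_y f u 0"
  define R where "R = 2 * norm g / \<mu>"
  have R: "R \<ge> 0" unfolding R_def using pos by simp
  have "continuous_on (cball 0 R) (\<lambda>v. f (u, v))"
    using f_section_derivative has_derivative_continuous
    by (metis continuous_at_imp_continuous_on)
  then obtain v where v: "v \<in> cball 0 R" "\<And>w. w \<in> cball 0 R \<Longrightarrow> f (u, w) \<le> f (u, v)"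
    using continuous_attains_sup[of "cball 0 R" "\<lambda>v. f (u, v)"] R by auto
  have "f (u, w) \<le> f (u, v)" for w
  proof (cases "w \<in> cball 0 R")
    case False
    then have w: "\<mu> * norm w > 2 * norm g" using pos unfolding R_def by (simp add: field_simps)
    have "f (u, w) \<le> f (u, 0) + g \<bullet> w - \<mu> / 2 * (norm w)\<^sup>2"
      using strongly_concave[of u w 0] unfolding g_def by simp
    also have "g \<bullet> w \<le> norm g * norm w" by (rule norm_cauchy_schwarz)
    also have "norm g * norm w \<le> (\<mu> * norm w / 2) * norm w" using w by (intro mult_right_mono) auto
    finally have "f (u, w) \<le> f (u, 0)" by (simp add: power2_eq_square)
    also have "\<dots> \<le> f (u, v)" using v(2) R by simp
    finally show ?thesis .
  qed (use v in auto)
  then have "\<exists>v. \<forall>v'. f (u, v') \<le> f (u, v)" by blast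
  then show ?thesis
    unfolding maximizer_def by (rule someI2_ex) blast
qed

lemma primal_eq: "primal f u = f (u, maximizer u)"
  unfolding primal_def by (rule Greatest_equality) (auto simp: maximizer_max)

lemma grad_y_maximizer: "snd (grad f (u, maximizer u)) = 0"
proof -
  have "(\<lambda>h. snd (grad f (u, maximizer u)) \<bullet> h) = (\<lambda>h. 0)"
    by (rule differential_zero_maxmin[of "maximizer u" UNIV "\<lambda>v. f (u, v)"])
      (auto simp: maximizer_max f_section_derivative)
  then show ?thesis by (metis inner_eq_zero_iff)
qed

text \<open>Strong monotonicity of \<open>- grad_y f u\<close> against the change of \<open>grad_y f\<close> in its first argument.\<close>

lemma maximizer_lipschitz: "norm (maximizer u - maximizer u') \<le> L / \<mu> * norm (u - u')"
proof -
  define d where "d = maximizer u - maximizer u'"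
  define q where "q = snd (grad f (u, maximizer u')) - snd (grad f (u', maximizer u'))"
  have "\<mu> * (norm d)\<^sup>2 \<le> q \<bullet> d"
    using grad_y_monotone[of u "maximizer u" "maximizer u'"]
    unfolding d_def[symmetric] q_def by (simp add: grad_y_maximizer)
  also have "\<dots> \<le> norm q * norm d" by (rule norm_cauchy_schwarz)
  also have "norm q \<le> norm (grad f (u, maximizer u') - grad f (u', maximizer u'))"
    unfolding q_def snd_diff[symmetric] by (rule norm_snd_le_norm)
  then have "norm q \<le> L * norm (u - u')"
    using grad_lipschitz_norm[of "(u, maximizer u')" "(u', maximizer u')"] by (simp add: norm_Pair)
  then have "norm q * norm d \<le> L * norm (u - u') * norm d"
    by (rule mult_right_mono) simp
  finally have "\<mu> * norm d \<le> L * norm (u - u')"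
    using pos by (cases "d = 0") (auto simp: power2_eq_square)
  then show ?thesis
    using pos unfolding d_def by (simp add: field_simps)
qed

lemma maximizer_graph_lipschitz:
  "norm ((u, maximizer u) - (u', maximizer u')) \<le> sqrt (1 + (L / \<mu>)\<^sup>2) * norm (u - u')"
  using norm_Pair_le_sqrt[OF maximizer_lipschitz] by simp

text \<open>The implicit function theorem for the equation \<open>grad_y f u (maximizer u) = 0\<close>. As the maximizer is
already known to be Lipschitz, it suffices to linearize the equation: the difference between the
increment \<open>w\<close> and the response to \<open>h\<close> is mapped by the coercive \<open>yy\<close>-block to an \<open>o(\<parallel>h\<parallel>)\<close> term.\<close>

lemma maximizer_derivative: "(maximizer has_derivative response (u, maximizer u)) (at u)"
  unfolding has_derivative_at_alt
proof (intro conjI allI impI)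
  let ?z = "(u, maximizer u)"
  show "bounded_linear (response ?z)"
    using linear_response linear_conv_bounded_linear by blast
  fix e :: real assume e: "e > 0"
  define C where "C = sqrt (1 + (L / \<mu>)\<^sup>2)"
  have C: "C > 0" unfolding C_def by (simp add: add_pos_nonneg)
  obtain d where d: "d > 0" "\<And>z'. norm (z' - ?z) < d \<Longrightarrow>
      norm (grad f z' - grad f ?z - hess_op f ?z (z' - ?z)) \<le> \<mu> * e / C * norm (z' - ?z)"
    using grad_derivative[of ?z] e C pos unfolding has_derivative_at_alt
    by (metis divide_pos_pos mult_pos_pos)
  show "\<exists>d>0. \<forall>u'. norm (u' - u) < d \<longrightarrow>
      norm (maximizer u' - maximizer u - response ?z (u' - u)) \<le> e * norm (u' - u)"
  proof (intro exI conjI allI impI)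
    show "d / C > 0" using d C by simp
    fix u' assume u': "norm (u' - u) < d / C"
    define h where "h = u' - u"
    define w where "w = maximizer u' - maximizer u"
    have zz: "(u', maximizer u') - ?z = (h, w)" unfolding h_def w_def by simp
    have n: "norm (h, w) \<le> C * norm h"
      using maximizer_graph_lipschitz[of u' u] unfolding zz C_def[symmetric] h_def[symmetric] .
    have "C * norm h < d" using u' C unfolding h_def by (simp add: field_simps)
    then have "norm (grad f (u', maximizer u') - grad f ?z - hess_op f ?z (h, w)) \<le> \<mu> * e / C * norm (h, w)"
      using d(2)[of "(u', maximizer u')"] n unfolding zz by simp
    also have "\<dots> \<le> \<mu> * e / C * (C * norm h)"
      using n pos e C by (intro mult_left_mono) auto
    also have "\<dots> = \<mu> * e * norm h" using C by simp
    finally have rem: "norm (grad f (u', maximizer u') - grad f ?z - hess_op f ?z (h, w)) \<le> \<mu> * e * norm h" .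
    have "hess_op f ?z (0, w - response ?z h) = hess_op f ?z (h, w) - hess_op f ?z (h, response ?z h)"
      by (simp add: linear_diff[OF linear_hess_op, symmetric])
    then have "snd (hess_op f ?z (0, w - response ?z h)) =
        - snd (grad f (u', maximizer u') - grad f ?z - hess_op f ?z (h, w))"
      by (simp add: response_equation grad_y_maximizer)
    then have "norm (snd (hess_op f ?z (0, w - response ?z h))) \<le> \<mu> * e * norm h"
      using rem norm_snd_le_norm order_trans by (simp only: norm_minus_cancel) blast
    then have "\<mu> * norm (w - response ?z h) \<le> \<mu> * (e * norm h)"
      using hess_yy_injective[of "w - response ?z h" ?z] by simp
    then show "norm (maximizer u' - maximizer u - response ?z (u' - u)) \<le> e * norm (u' - u)"
      using pos unfolding h_def w_def by simp
  qed
qed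

lemma maximizer_graph_derivative:
  "((\<lambda>u. (u, maximizer u)) has_derivative (\<lambda>h. (h, response (u, maximizer u) h))) (at u)"
  by (intro has_derivative_Pair has_derivative_ident maximizer_derivative)

text \<open>Danskin's theorem: the motion of the maximizer does not contribute because the \<open>y\<close>-gradient vanishes there.\<close>

lemma primal_derivative:
  "(primal f has_derivative (\<lambda>h. fst (grad f (u, maximizer u)) \<bullet> h)) (at u)"
proof -
  have "((\<lambda>u. f (u, maximizer u)) has_derivative
      (\<lambda>h. grad f (u, maximizer u) \<bullet> (h, response (u, maximizer u) h))) (at u)"
    by (rule has_derivative_compose[OF maximizer_graph_derivative f_derivative])
  then show ?thesis
    unfolding primal_eq[abs_def] by (simp add: inner_prod_def grad_y_maximizer)
qed

lemma grad_primal: "grad (primal f) u = fst (grad f (u, maximizer u))"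
  by (rule grad_eqI[OF primal_derivative])

lemma grad_primal_derivative:
  "(grad (primal f) has_derivative (\<lambda>h. schur_hess f u (maximizer u) *v h)) (at u)"
  unfolding grad_primal[abs_def] schur_hess_mult
  by (intro has_derivative_fst has_derivative_compose[OF maximizer_graph_derivative grad_derivative])

lemma hess_primal: "hess (primal f) u = schur_hess f u (maximizer u)"
  unfolding hess_def matrix_eq using jacobian_mult[OF grad_primal_derivative] by blast

lemma twice_differentiable_primal: "twice_differentiable_at (primal f) u"
  unfolding twice_differentiable_at_def differentiable_def
  using primal_derivative grad_primal_derivative by (auto intro!: always_eventually)

text \<open>The constant obtained is \<open>\<rho> (1 + \<kappa>\<^sup>2) sqrt (1 + \<kappa>\<^sup>2)\<close>, one factor \<open>sqrt (1 + \<kappa>\<^sup>2)\<close> coming from the graph of the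
maximizer and two from the responses; as \<open>\<kappa> \<ge> 1\<close> it is at most \<open>2 sqrt 2 \<kappa>\<^sup>3 \<rho>\<close>.\<close>

lemma hess_primal_lipschitz:
  "norm (hess (primal f) u *v h - hess (primal f) u' *v h)
     \<le> (4 * sqrt 2 * (L / \<mu>) ^ 3 * \<rho>) * norm (u - u') * norm h"
proof -
  define \<kappa> where "\<kappa> = L / \<mu>"
  have \<kappa>: "\<kappa> \<ge> 1" unfolding \<kappa>_def using mu_le_L pos by simp
  have sq: "1 + \<kappa>\<^sup>2 \<le> 2 * \<kappa>\<^sup>2" using \<kappa> by (simp add: one_le_power)
  have "sqrt (1 + \<kappa>\<^sup>2) \<le> sqrt (2 * \<kappa>\<^sup>2)" using sq by (rule real_sqrt_le_mono)
  also have "\<dots> = sqrt 2 * \<kappa>" using \<kappa> by (simp add: real_sqrt_mult)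
  finally have rt: "sqrt (1 + \<kappa>\<^sup>2) \<le> sqrt 2 * \<kappa>" .
  have "norm (hess (primal f) u *v h - hess (primal f) u' *v h)
      \<le> \<rho> * (1 + \<kappa>\<^sup>2) * norm ((u, maximizer u) - (u', maximizer u')) * norm h"
    unfolding hess_primal \<kappa>_def by (rule schur_hess_lipschitz)
  also have "\<dots> \<le> \<rho> * (2 * \<kappa>\<^sup>2) * ((sqrt 2 * \<kappa>) * norm (u - u')) * norm h"
  proof (intro mult_right_mono mult_mono)
    show "norm ((u, maximizer u) - (u', maximizer u')) \<le> (sqrt 2 * \<kappa>) * norm (u - u')"
      using maximizer_graph_lipschitz[of u u'] mult_right_mono[OF rt norm_ge_zero[of "u - u'"]]
      unfolding \<kappa>_def by linarith
  qed (use pos sq \<kappa> in auto)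
  also have "\<dots> = 1/2 * ((4 * sqrt 2 * \<kappa> ^ 3 * \<rho>) * norm (u - u') * norm h)"
    by (simp add: power2_eq_square power3_eq_cube)
  also have "\<dots> \<le> (4 * sqrt 2 * \<kappa> ^ 3 * \<rho>) * norm (u - u') * norm h"
    using pos \<kappa> by simp
  finally show ?thesis unfolding \<kappa>_def .
qed

end

section \<open>Minimax Cubic Newton\<close>

theorem theorem1:
  fixes f :: "(real^'n) \<times> (real^'m) \<Rightarrow> real"
    and L \<rho> \<mu> \<kappa> M \<epsilon> :: real
    and x0 :: "real^'n"
    and T N :: nat and K :: "nat \<Rightarrow> nat"
    and x s :: "nat \<Rightarrow> real^'n" and y :: "nat \<Rightarrow> real^'m"
  assumes pos: "L > 0" "\<rho> > 0" "\<mu> > 0"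
    and twice_diff: "\<And>z. twice_differentiable_at f z"
    and A1: "\<And>u u' v v'. (norm (grad f (u, v) - grad f (u', v')))\<^sup>2
               \<le> L\<^sup>2 * ((norm (u - u'))\<^sup>2 + (norm (v - v'))\<^sup>2)"
    and A2: "\<And>u u' v v'. (onorm (\<lambda>h. hess_op f (u, v) h - hess_op f (u', v') h))\<^sup>2
               \<le> \<rho>\<^sup>2 * ((norm (u - u'))\<^sup>2 + (norm (v - v'))\<^sup>2)"
    and A3: "\<And>u v v'. f (u, v)
               \<le> f (u, v') + grad_y f u v' \<bullet> (v - v') - \<mu> / 2 * (norm (v - v'))\<^sup>2"
    and A4: "bdd_below (range (primal f))"
    and kappa: "\<kappa> = L / \<mu>"
    and eps: "\<epsilon> > 0"
    and M: "M = 4 * sqrt 2 * \<kappa> ^ 3 * \<rho>"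
    and T: "T = nat \<lceil>192 * (primal f x0 - (INF u. primal f u)) * sqrt M * \<epsilon> powr (-1.5)\<rceil> + 1"
    and run: "mcn_run f L \<kappa> M \<epsilon> T K x0 N x y s"
    and grad_err: "\<And>t. t \<le> N \<Longrightarrow>
               norm (grad (primal f) (x t) - grad_x f (x t) (y t)) \<le> 1/192 * \<epsilon>"
    and hess_err: "\<And>t. t \<le> N \<Longrightarrow>
               spectral_norm (hess (primal f) (x t) - schur_hess f (x t) (y t))
                 \<le> 1/48 * sqrt (M * \<epsilon>)"
  shows "second_order_stationary (primal f) \<epsilon> (sqrt (M * \<epsilon>)) (x N + s N)"
proof -
  interpret smooth_strongly_concave f L \<rho> \<mu>
    using pos twice_diff A1 A2 A3 by unfold_locales
  let ?P = "primal f"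
  have "\<kappa> > 0" using pos kappa by simp
  then have Mpos: "M > 0" unfolding M using pos by simp
  \<comment> \<open>The length scale in which both tolerances are homogeneous.\<close>
  define e where "e = sqrt (\<epsilon> / M)"
  have e: "e > 0" unfolding e_def using eps Mpos by simp
  have Me2: "M * e\<^sup>2 = \<epsilon>" unfolding e_def using eps Mpos by simp
  have "M * \<epsilon> = (M * e)\<^sup>2" unfolding Me2[symmetric] by (simp add: power2_eq_square)
  then have Me: "sqrt (M * \<epsilon>) = M * e" using Mpos e by simp
  \<comment> \<open>The decrease per long step, in the form in which \<open>T\<close> is given.\<close>
  have per_step: "M * e ^ 3 = 1 / (sqrt M * \<epsilon> powr (-1.5))"
  proof -
    have "\<epsilon> powr (-1.5) = 1 / (\<epsilon> * sqrt \<epsilon>)"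
      using eps powr_add[of \<epsilon> 1 "1/2"] by (simp add: powr_minus_divide powr_half_sqrt)
    moreover have "M * e ^ 3 = M * e\<^sup>2 * e" by (simp add: power3_eq_cube power2_eq_square)
    moreover have "e = sqrt \<epsilon> / sqrt M" unfolding e_def by (simp add: real_sqrt_divide)
    ultimately have "M * e ^ 3 = \<epsilon> * (sqrt \<epsilon> / sqrt M)" unfolding Me2 by simp
    then show ?thesis
      unfolding \<open>\<epsilon> powr (-1.5) = 1 / (\<epsilon> * sqrt \<epsilon>)\<close> using eps Mpos by (simp add: field_simps)
  qed
  have run_y: "is_arg_min (cubic_model (grad_x f (x t) (y t)) (schur_hess f (x t) (y t)) M) (\<lambda>_. True) (s t)"
    if "t \<le> N" for t
    using run that unfolding mcn_run_def by blast
  have step: "inexact_cubic_step ?P (grad ?P) (\<lambda>u h. hess ?P u *v h) M e (x t) (s t)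
      (grad_x f (x t) (y t)) (schur_hess f (x t) (y t))" if t: "t \<le> N" for t
  proof
    show "(?P has_derivative (\<lambda>h. grad ?P z \<bullet> h)) (at z)" for z
      using primal_derivative grad_primal by simp
    show "(grad ?P has_derivative (\<lambda>h. hess ?P z *v h)) (at z)" for z
      using grad_primal_derivative hess_primal by simp
    show "norm (hess ?P z *v h - hess ?P w *v h) \<le> M * norm (z - w) * norm h" for z w h
      using hess_primal_lipschitz unfolding M kappa .
    show "norm (grad ?P (x t) - grad_x f (x t) (y t)) \<le> M * e\<^sup>2 / 192"
      using grad_err[OF t] by (simp add: Me2)
    fix h
    have "norm ((hess ?P (x t) - schur_hess f (x t) (y t)) *v h)
        \<le> spectral_norm (hess ?P (x t) - schur_hess f (x t) (y t)) * norm h"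
      by (rule norm_matrix_vector_le_spectral_norm)
    also have "\<dots> \<le> M * e / 48 * norm h"
      using hess_err[OF t] Me by (intro mult_right_mono) auto
    finally show "norm (hess ?P (x t) *v h - schur_hess f (x t) (y t) *v h) \<le> M * e / 48 * norm h"
      by (simp add: matrix_vector_mult_diff_rdistrib)
  qed (use Mpos e schur_hess_symmetric run_y[OF t] in auto)
  have decrease: "?P (x t + s t) < ?P (x t) - M * e ^ 3 / 192"
    if "t \<le> N" "\<not> norm (s t) \<le> (1/2) * e" for t
    using inexact_cubic_step.long_step_decreases[OF step] that by simp
  have x_Suc: "x (Suc t) = x t + s t" and long: "\<not> norm (s t) \<le> (1/2) * e" if "t < N" for t
    using run that unfolding mcn_run_def e_def by auto
  have x0: "x 0 = x0" using run unfolding mcn_run_def by simp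
  have progress: "t \<le> N \<Longrightarrow> ?P (x t) \<le> ?P x0 - t * (M * e ^ 3 / 192)" for t
  proof (induction t)
    case (Suc t)
    then have "?P (x (Suc t)) < ?P (x t) - M * e ^ 3 / 192"
      using decrease[OF _ long] x_Suc by simp
    moreover have "?P (x t) \<le> ?P x0 - t * (M * e ^ 3 / 192)" using Suc by simp
    moreover have "real (Suc t) * (M * e ^ 3 / 192) = t * (M * e ^ 3 / 192) + M * e ^ 3 / 192"
      by (simp add: distrib_right)
    ultimately show ?case by linarith
  qed (simp add: x0)
  \<comment> \<open>If even the last step were long, the \<open>T\<close> long steps would together decrease the primal function by more
      than its distance to the infimum.\<close>
  have short: "norm (s N) \<le> e / 2"
  proof (rule ccontr)
    assume "\<not> norm (s N) \<le> e / 2"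
    then have long_N: "\<not> norm (s N) \<le> (1/2) * e" by simp
    then have NT: "Suc N = T"
      using run unfolding mcn_run_def e_def by auto
    define c where "c = 192 * (?P x0 - (INF u. ?P u)) * sqrt M * \<epsilon> powr (-1.5)"
    have "(INF u. ?P u) \<le> ?P (x N + s N)"
      using A4 by (intro cINF_lower) auto
    also have "\<dots> < ?P x0 - real (Suc N) * (M * e ^ 3 / 192)"
    proof -
      have "real (Suc N) * (M * e ^ 3 / 192) = N * (M * e ^ 3 / 192) + M * e ^ 3 / 192"
        by (simp add: distrib_right)
      then show ?thesis
        using decrease[OF order_refl long_N] progress[OF order_refl] by linarith
    qed
    finally have "real T * (M * e ^ 3) < 192 * (?P x0 - (INF u. ?P u))"
      unfolding NT by simp
    then have "real T < c"
      using Mpos eps unfolding per_step c_def by (simp add: field_simps)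
    moreover have "c \<le> real T"
      unfolding T c_def[symmetric] by linarith
    ultimately show False by simp
  qed
  interpret last: inexact_cubic_step ?P "grad ?P" "\<lambda>u h. hess ?P u *v h" M e "x N" "s N"
      "grad_x f (x N) (y N)" "schur_hess f (x N) (y N)"
    by (rule step) simp
  have "norm (grad ?P (x N + s N)) \<le> \<epsilon>"
    using last.short_step_gradient[OF short] by (simp add: Me2)
  moreover have "loewner_ge (hess ?P (x N + s N)) (- (sqrt (M * \<epsilon>) *\<^sub>R mat 1))"
  proof -
    let ?H = "hess ?P (x N + s N)"
    let ?A = "?H - - (sqrt (M * \<epsilon>) *\<^sub>R mat 1)"
    have A: "?A *v v = ?H *v v + (M * e) *\<^sub>R v" for v
      by (simp add: Me matrix_vector_mult_add_rdistrib scaleR_matrix_vector_assoc[symmetric])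
    have "k \<bullet> (?H *v h) = (?H *v k) \<bullet> h" for k h
      unfolding hess_primal by (rule schur_hess_symmetric)
    then have "k \<bullet> (?A *v h) = (?A *v k) \<bullet> h" for k h
      unfolding A by (simp only: inner_add_left inner_add_right inner_scaleR_left inner_scaleR_right)
    then have "(transpose ?A *v k) \<bullet> h = (?A *v k) \<bullet> h" for k h
      by (simp only: transpose_matrix_vector dot_lmul_matrix)
    then have "transpose ?A *v k = ?A *v k" for k
      using vector_eq_rdot by blast
    then have "transpose ?A = ?A"
      unfolding matrix_eq by blast
    moreover have "0 \<le> v \<bullet> (?A *v v)" for v
      using last.short_step_curvature[OF short, of v]
      unfolding A by (simp add: inner_add_right dot_square_norm)
    ultimately show ?thesis unfolding loewner_ge_def by blast
  qed
  ultimately show ?thesis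
    unfolding second_order_stationary_def using twice_differentiable_primal by blast
qed

end
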